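(* Let $f(t)=\sum_{k=0}^{4}a_kt^k$ be a real quartic polynomial with $a_k>0$ for $k=0,\dots,4$. Suppose that $$a_k^2>\frac{k+1}{k}\,a_{k-1}a_{k+1}\qquad\text{for }k=1,2,3.$$ Then $f(t)$ is Hurwitz-stable.
   Context: A univariate polynomial is Hurwitz-stable if all its (complex) roots have negative real part. *)

theory Defs
  imports Complex_Main "HOL-Computational_Algebra.Polynomial"
begin

(* A real polynomial f is Hurwitz-stable in this sense when its complexification
   map_poly complex_of_real f is: the roots considered are always the complex ones.
   The zero polynomial is not stable; nonzero constants are, vacuously. *)
definition hurwitz_stable :: "complex poly \<Rightarrow> bool" where
  "hurwitz_stable p \<longleftrightarrow> (\<forall>z. poly p z = 0 \<longrightarrow> Re z < 0)"

end

theory Submission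
  imports Defs
begin

text \<open>
  The quartic case of the Routh-Hurwitz criterion says that a real quartic with positive
  coefficients is stable as soon as \<open>a1 * a2 * a3 > a0 * a3\<^sup>2 + a1\<^sup>2 * a4\<close>
  (\<open>routh_hurwitz_quartic\<close>). The three hypotheses give this with room to spare: the first and
  third bound the two terms on the right by \<open>(a1 * a3)\<^sup>2 / (2 * a2)\<close> and
  \<open>3 * (a1 * a3)\<^sup>2 / (4 * a2)\<close>, and the second, \<open>a1 * a3 < 2/3 * a2\<^sup>2\<close>, turns these into
  one third and one half of \<open>a1 * a2 * a3\<close>, so that the right-hand side is less than
  \<open>5/6 * a1 * a2 * a3\<close>.

  As to the criterion itself, a real root is negative because a polynomial with positive
  coefficients is positive at every \<open>t \<ge> 0\<close>. A nonreal root \<open>z\<close> makes the quartic a multiple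
  of \<open>t\<^sup>2 + p * t + q\<close>, where \<open>p = -2 * Re z\<close> and \<open>q = \<bar>z\<bar>\<^sup>2\<close>; write \<open>b2 * t\<^sup>2 + b1 * t + b0\<close>
  for the cofactor. The Hurwitz determinant is, up to normalisation, the product of the sums of
  two roots, and in these terms it is
  \<open>p * b1 * ((b0 - q * b2)\<^sup>2 + a1 * a3)\<close>: the factors \<open>p\<close> and \<open>b1\<close> come from the pairs
  inside one quadratic factor, the bracket from the mixed pairs. So \<open>p\<close> and \<open>b1\<close> have the same
  sign, and since \<open>p * b2 + b1 = a3 > 0\<close> both are positive, that is, \<open>Re z < 0\<close>.
\<close>

text \<open>
  For nonreal \<open>z\<close>, the numbers \<open>1\<close> and \<open>z\<close> are linearly independent over the reals. Hence the
  remainder of the division by the minimal polynomial of \<open>z\<close>, being linear and zero at \<open>z\<close>,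
  vanishes identically.
\<close>
lemma quartic_factor_of_nonreal_root:
  fixes a0 a1 a2 a3 a4 :: real and z :: complex
  assumes root: "of_real a0 + of_real a1 * z + of_real a2 * z^2 + of_real a3 * z^3
      + of_real a4 * z^4 = 0"
    and nonreal: "Im z \<noteq> 0"
  obtains b0 b1 where
    "a0 = (cmod z)\<^sup>2 * b0"
    "a1 = -2 * Re z * b0 + (cmod z)\<^sup>2 * b1"
    "a2 = b0 + -2 * Re z * b1 + (cmod z)\<^sup>2 * a4"
    "a3 = b1 + -2 * Re z * a4"
proof -
  define p where "p = -2 * Re z"
  define q where "q = (cmod z)\<^sup>2"
  \<comment> \<open>Long division by \<open>t\<^sup>2 + p * t + q\<close>, with remainder \<open>r1 * t + r0\<close>.\<close>
  define b1 where "b1 = a3 - p * a4"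
  define b0 where "b0 = a2 - p * b1 - q * a4"
  define r1 where "r1 = a1 - p * b0 - q * b1"
  define r0 where "r0 = a0 - q * b0"
  have q: "q = (Re z)\<^sup>2 + (Im z)\<^sup>2"
    by (simp add: q_def cmod_power2)
  have quad: "z^2 + of_real p * z + of_real q = 0"
    by (rule complex_eqI) (simp_all add: p_def q power2_eq_square)
  have a: "a0 = q * b0 + r0" "a1 = p * b0 + q * b1 + r1" "a2 = b0 + p * b1 + q * a4"
      "a3 = b1 + p * a4"
    by (simp_all add: r0_def r1_def b0_def b1_def)
  have "of_real a0 + of_real a1 * z + of_real a2 * z^2 + of_real a3 * z^3 + of_real a4 * z^4
      = (z^2 + of_real p * z + of_real q) * (of_real a4 * z^2 + of_real b1 * z + of_real b0)
        + of_real r1 * z + of_real r0"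
    unfolding a of_real_add of_real_mult by algebra
  then have rem: "of_real r1 * z + of_real r0 = (0 :: complex)"
    using root quad by simp
  have "r1 = 0"
    using arg_cong[OF rem, of Im] nonreal by simp
  moreover have "r0 = 0"
    using rem \<open>r1 = 0\<close> by simp
  ultimately show thesis
    using that[of b0 b1] a unfolding p_def q_def by simp
qed

text \<open>
  The bracket on the right is the resultant of \<open>t\<^sup>2 + p * t + q\<close> and
  \<open>b2 * t\<^sup>2 - b1 * t + b0\<close>, the cofactor reflected at the origin. It vanishes when a
  root of one factor is the negative of a root of the other.
\<close>
lemma hurwitz_determinant_factored:
  fixes b0 b1 b2 p q :: real
  assumes "a0 = q * b0" "a1 = p * b0 + q * b1" "a2 = b0 + p * b1 + q * b2" "a3 = b1 + p * b2"
  shows "a1 * a2 * a3 - a0 * a3\<^sup>2 - a1\<^sup>2 * b2 = p * b1 * ((b0 - q * b2)\<^sup>2 + a1 * a3)"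
  unfolding assms by (simp add: power2_eq_square algebra_simps)

theorem routh_hurwitz_quartic:
  fixes a0 a1 a2 a3 a4 :: real
  assumes pos: "a0 > 0" "a1 > 0" "a2 > 0" "a3 > 0" "a4 > 0"
    and det: "a1 * a2 * a3 > a0 * a3\<^sup>2 + a1\<^sup>2 * a4"
  shows "hurwitz_stable (map_poly complex_of_real [:a0, a1, a2, a3, a4:])"
  unfolding hurwitz_stable_def
proof (intro allI impI)
  fix z :: complex
  assume "poly (map_poly complex_of_real [:a0, a1, a2, a3, a4:]) z = 0"
  then have root: "of_real a0 + of_real a1 * z + of_real a2 * z^2 + of_real a3 * z^3
      + of_real a4 * z^4 = 0"
    by (simp add: map_poly_pCons algebra_simps power2_eq_square power3_eq_cube power4_eq_xxxx)
  show "Re z < 0"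
  proof (cases "Im z = 0")
    case True
    then obtain x where z: "z = of_real x"
      by (metis complex_is_Real_iff Reals_cases)
    from root have "of_real (a0 + a1 * x + a2 * x^2 + a3 * x^3 + a4 * x^4) = (0 :: complex)"
      unfolding z by simp
    then have "a0 + a1 * x + a2 * x^2 + a3 * x^3 + a4 * x^4 = 0"
      by (simp only: of_real_eq_0_iff)
    moreover have "a0 + a1 * x + a2 * x^2 + a3 * x^3 + a4 * x^4 > 0" if "x \<ge> 0"
      using pos that by (intro add_pos_nonneg) auto
    ultimately show ?thesis
      unfolding z by fastforce
  next
    case False
    obtain b0 b1 where b: "a0 = (cmod z)\<^sup>2 * b0"
        "a1 = -2 * Re z * b0 + (cmod z)\<^sup>2 * b1"
        "a2 = b0 + -2 * Re z * b1 + (cmod z)\<^sup>2 * a4"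
        "a3 = b1 + -2 * Re z * a4"
      using quartic_factor_of_nonreal_root[OF root False] .
    have "-2 * Re z * b1 * ((b0 - (cmod z)\<^sup>2 * a4)\<^sup>2 + a1 * a3) > 0"
      using hurwitz_determinant_factored[OF b] det by linarith
    moreover have "(b0 - (cmod z)\<^sup>2 * a4)\<^sup>2 + a1 * a3 > 0"
      using pos by (intro add_nonneg_pos) auto
    ultimately have same_sign: "-2 * Re z * b1 > 0"
      by (rule zero_less_mult_pos2)
    show ?thesis
    proof (rule ccontr)
      assume "\<not> Re z < 0"
      with same_sign have "b1 < 0"
        by (auto simp: zero_less_mult_iff mult_less_0_iff)
      moreover have "0 \<le> Re z * a4"
        using \<open>\<not> Re z < 0\<close> pos by simp
      ultimately show False
        using b(4) pos(4) by linarith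
    qed
  qed
qed

lemma hurwitz_determinant_pos:
  fixes a0 a1 a2 a3 a4 :: real
  assumes pos: "a1 > 0" "a2 > 0" "a3 > 0"
    and i1: "a1\<^sup>2 > 2 * a0 * a2"
    and i2: "a2\<^sup>2 > 3/2 * a1 * a3"
    and i3: "a3\<^sup>2 > 4/3 * a2 * a4"
  shows "a1 * a2 * a3 > a0 * a3\<^sup>2 + a1\<^sup>2 * a4"
proof -
  have "2 * a0 * a2 * a3\<^sup>2 < a1\<^sup>2 * a3\<^sup>2"
    using i1 pos by (intro mult_strict_right_mono) auto
  moreover have "a1\<^sup>2 * (4/3 * a2 * a4) < a1\<^sup>2 * a3\<^sup>2"
    using i3 pos by (intro mult_strict_left_mono) auto
  moreover have "(a1 * a3) * (3/2 * a1 * a3) < (a1 * a3) * a2\<^sup>2"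
    using i2 pos by (intro mult_strict_left_mono) auto
  moreover have "0 < a2 * (a1 * a2 * a3)"
    using pos by simp
  ultimately have "a2 * (a0 * a3\<^sup>2 + a1\<^sup>2 * a4) < a2 * (a1 * a2 * a3)"
    by (simp add: power2_eq_square algebra_simps)
  then show ?thesis
    using pos by simp
qed

theorem proposition4p14:
  fixes f :: "real poly" and a :: "nat \<Rightarrow> real"
  assumes f_eq: "f = (\<Sum>k=0..4. monom (a k) k)"
    and pos: "\<And>k. k \<in> {0..4} \<Longrightarrow> a k > 0"
    and ineq: "\<And>k. k \<in> {1, 2, 3} \<Longrightarrow>
      (a k)\<^sup>2 > (real k + 1) / real k * a (k - 1) * a (k + 1)"
  shows "hurwitz_stable (map_poly complex_of_real f)"
proof -
  have f: "f = [:a 0, a 1, a 2, a 3, a 4:]"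
    unfolding f_eq by (simp add: eval_nat_numeral monom_Suc monom_0)
  have apos: "a 0 > 0" "a 1 > 0" "a 2 > 0" "a 3 > 0" "a 4 > 0"
    using pos by simp_all
  have "(a 1)\<^sup>2 > 2 * a 0 * a 2"
    using ineq[of 1, unfolded one_add_one] by simp
  moreover have "(a 2)\<^sup>2 > 3/2 * a 1 * a 3"
    using ineq[of 2] by simp
  moreover have "(a 3)\<^sup>2 > 4/3 * a 2 * a 4"
    using ineq[of 3] by simp
  ultimately have "a 1 * a 2 * a 3 > a 0 * (a 3)\<^sup>2 + (a 1)\<^sup>2 * a 4"
    using apos by (intro hurwitz_determinant_pos)
  with apos show ?thesis
    unfolding f by (intro routh_hurwitz_quartic)
qed

end
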